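(* Let $(X,A)$ be a locally compact pair and let $(P,\ast)$ be a pointed polyhedron. Then the set $\mathrm{Ph}((X,A),(P,\ast))$ of phantom maps from $(X,A)$ to $(P,\ast)$ is the closure, in the space of all maps $(X,A)\to(P,\ast)$ with the compact-open topology, of the class $[\ast]$ of maps homotopic to the constant map $\ast$.
   Context: A locally compact pair $(X,A)$ is a locally compact Polish space $X$ with a closed (possibly empty) subspace $A$. A pointed polyhedron is the realization of a countable locally finite simplicial complex with a distinguished point $\ast$. Maps $(X,A)\to(P,\ast)$ are continuous $f:X\to P$ with $f(A)\subseteq\{\ast\}$. Homotopies between such maps are continuous $h:X\times[0,1]\to P$ with $h(A\times[0,1])\subseteq\{\ast\}$. Maps $f,g:(X,A)\to(P,\ast)$ are weakly homotopic if for every compact $K\subseteq X$ the restrictions $f|_K,g|_K:(K,K\cap A)\to(P,\ast)$ are homotopic. A phantom map is a map weakly homotopic to the constant map $\ast$. *)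

theory Defs
  imports "HOL-Analysis.Analysis"
begin

section \<open>Locally compact pairs\<close>

definition locally_compact_pair :: "'a topology \<Rightarrow> 'a set \<Rightarrow> bool" where
  "locally_compact_pair X A \<longleftrightarrow>
     completely_metrizable_space X \<and> separable_space X \<and> locally_compact_space X \<and> closedin X A"


section \<open>Pointed polyhedra\<close>

definition abstract_simplicial_complex :: "'v set set \<Rightarrow> bool" where
  "abstract_simplicial_complex \<K> \<longleftrightarrow>
     (\<forall>s\<in>\<K>. finite s \<and> s \<noteq> {}) \<and> (\<forall>s\<in>\<K>. \<forall>t. t \<subseteq> s \<and> t \<noteq> {} \<longrightarrow> t \<in> \<K>)"

definition locally_finite_complex :: "'v set set \<Rightarrow> bool" where
  "locally_finite_complex \<K> \<longleftrightarrow> (\<forall>v\<in>\<Union>\<K>. finite {s \<in> \<K>. v \<in> s})"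

text \<open>Points are given by their barycentric coordinates.\<close>

definition closed_simplex :: "'v set \<Rightarrow> ('v \<Rightarrow> real) set" where
  "closed_simplex s = {x. (\<forall>v. 0 \<le> x v) \<and> (\<forall>v. v \<notin> s \<longrightarrow> x v = 0) \<and> sum x s = 1}"

text \<open>The weak topology. For finite \<open>s\<close>, the product topology of \<open>'v \<Rightarrow> real\<close> restricts to the
  usual Euclidean topology on \<open>closed_simplex s\<close>.\<close>

definition realization :: "'v set set \<Rightarrow> ('v \<Rightarrow> real) topology" where
  "realization \<K> = topology (\<lambda>U. U \<subseteq> (\<Union>s\<in>\<K>. closed_simplex s) \<and>
     (\<forall>s\<in>\<K>. openin (top_of_set (closed_simplex s)) (U \<inter> closed_simplex s)))"

lemma openin_realization:
  "openin (realization \<K>) U \<longleftrightarrow> U \<subseteq> (\<Union>s\<in>\<K>. closed_simplex s) \<and>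
     (\<forall>s\<in>\<K>. openin (top_of_set (closed_simplex s)) (U \<inter> closed_simplex s))"
proof -
  let ?L = "\<lambda>U. U \<subseteq> (\<Union>s\<in>\<K>. closed_simplex s) \<and>
     (\<forall>s\<in>\<K>. openin (top_of_set (closed_simplex s)) (U \<inter> closed_simplex s))"
  have "istopology ?L"
    unfolding istopology_def
  proof (intro conjI allI impI)
    fix S T assume S: "?L S" and T: "?L T"
    show "S \<inter> T \<subseteq> (\<Union>s\<in>\<K>. closed_simplex s)" using S by blast
    show "\<forall>s\<in>\<K>. openin (top_of_set (closed_simplex s)) (S \<inter> T \<inter> closed_simplex s)"
    proof
      fix s assume "s \<in> \<K>"
      with S T have "openin (top_of_set (closed_simplex s))
          ((S \<inter> closed_simplex s) \<inter> (T \<inter> closed_simplex s))"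
        by (blast intro: openin_Int)
      moreover have "(S \<inter> closed_simplex s) \<inter> (T \<inter> closed_simplex s) = S \<inter> T \<inter> closed_simplex s"
        by blast
      ultimately show "openin (top_of_set (closed_simplex s)) (S \<inter> T \<inter> closed_simplex s)"
        by simp
    qed
  next
    fix \<U> assume U: "\<forall>U\<in>\<U>. ?L U"
    show "\<Union>\<U> \<subseteq> (\<Union>s\<in>\<K>. closed_simplex s)" using U by blast
    show "\<forall>s\<in>\<K>. openin (top_of_set (closed_simplex s)) (\<Union>\<U> \<inter> closed_simplex s)"
    proof
      fix s assume "s \<in> \<K>"
      with U have "openin (top_of_set (closed_simplex s)) (\<Union>U\<in>\<U>. U \<inter> closed_simplex s)"
        by (blast intro: openin_Union)
      moreover have "(\<Union>U\<in>\<U>. U \<inter> closed_simplex s) = \<Union>\<U> \<inter> closed_simplex s"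
        by blast
      ultimately show "openin (top_of_set (closed_simplex s)) (\<Union>\<U> \<inter> closed_simplex s)"
        by simp
    qed
  qed
  then show ?thesis
    unfolding realization_def by (simp only: topology_inverse')
qed

lemma topspace_realization: "topspace (realization \<K>) = (\<Union>s\<in>\<K>. closed_simplex s)"
proof
  show "topspace (realization \<K>) \<subseteq> (\<Union>s\<in>\<K>. closed_simplex s)"
    by (metis openin_realization openin_topspace)
  have "openin (realization \<K>) (\<Union>s\<in>\<K>. closed_simplex s)"
    unfolding openin_realization
  proof (intro conjI ballI order_refl)
    fix s assume "s \<in> \<K>"
    then have "(\<Union>s\<in>\<K>. closed_simplex s) \<inter> closed_simplex s = closed_simplex s"
      by blast
    then show "openin (top_of_set (closed_simplex s)) ((\<Union>s\<in>\<K>. closed_simplex s) \<inter> closed_simplex s)"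
      by simp
  qed
  then show "(\<Union>s\<in>\<K>. closed_simplex s) \<subseteq> topspace (realization \<K>)"
    by (rule openin_subset)
qed


section \<open>Maps of pairs, homotopies and phantom maps\<close>

text \<open>Maps out of \<open>X\<close> are represented by functions that are \<open>undefined\<close> outside \<open>topspace X\<close>.\<close>

definition pair_maps :: "'a topology \<Rightarrow> 'a set \<Rightarrow> 'b topology \<Rightarrow> 'b \<Rightarrow> ('a \<Rightarrow> 'b) set" where
  "pair_maps X A P p = {f \<in> extensional (topspace X). continuous_map X P f \<and> f ` A \<subseteq> {p}}"

definition const_map :: "'a topology \<Rightarrow> 'b \<Rightarrow> 'a \<Rightarrow> 'b" where
  "const_map X p = (\<lambda>x\<in>topspace X. p)"

definition pair_homotopic ::
    "'a topology \<Rightarrow> 'a set \<Rightarrow> 'b topology \<Rightarrow> 'b \<Rightarrow> ('a \<Rightarrow> 'b) \<Rightarrow> ('a \<Rightarrow> 'b) \<Rightarrow> bool" where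
  "pair_homotopic X A P p f g \<longleftrightarrow> homotopic_with (\<lambda>h. h ` A \<subseteq> {p}) X P f g"

definition weakly_homotopic ::
    "'a topology \<Rightarrow> 'a set \<Rightarrow> 'b topology \<Rightarrow> 'b \<Rightarrow> ('a \<Rightarrow> 'b) \<Rightarrow> ('a \<Rightarrow> 'b) \<Rightarrow> bool" where
  "weakly_homotopic X A P p f g \<longleftrightarrow>
     (\<forall>K. compactin X K \<longrightarrow>
        pair_homotopic (subtopology X K) (K \<inter> A) P p (restrict f K) (restrict g K))"

definition phantom_maps :: "'a topology \<Rightarrow> 'a set \<Rightarrow> 'b topology \<Rightarrow> 'b \<Rightarrow> ('a \<Rightarrow> 'b) set" where
  "phantom_maps X A P p = {f \<in> pair_maps X A P p. weakly_homotopic X A P p f (const_map X p)}"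

definition null_homotopic_maps :: "'a topology \<Rightarrow> 'a set \<Rightarrow> 'b topology \<Rightarrow> 'b \<Rightarrow> ('a \<Rightarrow> 'b) set" where
  "null_homotopic_maps X A P p = {f \<in> pair_maps X A P p. pair_homotopic X A P p f (const_map X p)}"


section \<open>The compact-open topology\<close>

definition compact_open_topology :: "'a topology \<Rightarrow> 'b topology \<Rightarrow> ('a \<Rightarrow> 'b) topology" where
  "compact_open_topology X Y = topology_generated_by
     {{f \<in> extensional (topspace X). continuous_map X Y f \<and> f ` K \<subseteq> U} | K U.
        compactin X K \<and> openin Y U}"

lemma topspace_compact_open_topology:
  "topspace (compact_open_topology X Y) = {f \<in> extensional (topspace X). continuous_map X Y f}"
proof -
  have "{f \<in> extensional (topspace X). continuous_map X Y f} =
      {f \<in> extensional (topspace X). continuous_map X Y f \<and> f ` {} \<subseteq> {}}"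
    by simp
  then have "{f \<in> extensional (topspace X). continuous_map X Y f} \<in>
     {{f \<in> extensional (topspace X). continuous_map X Y f \<and> f ` K \<subseteq> U} | K U.
        compactin X K \<and> openin Y U}"
    using compactin_empty[of X] openin_empty[of Y] by blast
  then show ?thesis
    unfolding compact_open_topology_def topology_generated_by_topspace by blast
qed

definition pair_maps_topology ::
    "'a topology \<Rightarrow> 'a set \<Rightarrow> 'b topology \<Rightarrow> 'b \<Rightarrow> ('a \<Rightarrow> 'b) topology" where
  "pair_maps_topology X A P p = subtopology (compact_open_topology X P) (pair_maps X A P p)"

lemma topspace_pair_maps_topology: "topspace (pair_maps_topology X A P p) = pair_maps X A P p"
  by (auto simp: pair_maps_topology_def topspace_compact_open_topology pair_maps_def)

end

theory Submission
  imports Defs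
begin

text \<open>
  For a phantom map \<open>f\<close> and a compact set \<open>K\<close>, a null-homotopy of \<open>f\<close> on a compact neighbourhood of
  \<open>K\<close>, cut off by a Urysohn function, gives a null-homotopic map that agrees with \<open>f\<close> on \<open>K\<close>.
  Conversely, two maps into a locally finite polyhedron whose values always lie in a common open
  vertex star are homotopic, relative to the set where they agree, through the normalised minimum of
  their barycentric coordinates; being in a common star on a compact set is a compact-open
  neighbourhood condition.
\<close>

section \<open>Simplices and the topology of a locally finite realization\<close>

lemma closed_simplex_positive_vertex:
  assumes "x \<in> closed_simplex s"
  obtains v where "v \<in> s" "0 < x v"
proof -
  have "sum x s = 1"
    using assms by (simp add: closed_simplex_def)
  then obtain v where "v \<in> s" "x v \<noteq> 0"
    by (metis sum.neutral zero_neq_one)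
  moreover have "0 \<le> x v"
    using assms by (simp add: closed_simplex_def)
  ultimately show thesis
    using that by force
qed

lemma closed_simplex_pos_imp_mem: "x \<in> closed_simplex s \<Longrightarrow> 0 < x v \<Longrightarrow> v \<in> s"
  by (force simp: closed_simplex_def)

lemma convex_combination_closed_simplex:
  assumes "x \<in> closed_simplex s" "y \<in> closed_simplex s" "0 \<le> t" "t \<le> 1"
  shows "(\<lambda>v. (1 - t) * x v + t * y v) \<in> closed_simplex s"
  using assms by (auto simp: closed_simplex_def sum.distrib simp flip: sum_distrib_left)

lemma open_coordinate_greater: "open {y::'v \<Rightarrow> real. c < y v}"
proof -
  \<comment> \<open>The basis lemma takes a finite family of coordinates; the family indexed by
    \<open>()\<close> alone picks out \<open>v\<close>.\<close>
  have "open {f::'v \<Rightarrow> real. \<forall>i\<in>{()}. f ((\<lambda>_. v) i) \<in> {c<..}}"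
    by (rule product_topology_basis') auto
  then show ?thesis
    by simp
qed

lemma closed_closed_simplex: "closed (closed_simplex s)"
proof -
  have "closed_simplex s =
      (\<Inter>v. {x. 0 \<le> x v}) \<inter> (\<Inter>v\<in>- s. {x. x v = 0}) \<inter> {x. (\<Sum>v\<in>s. x v) = 1}"
    by (auto simp: closed_simplex_def)
  also have "closed \<dots>"
    by (intro closed_Int closed_INT ballI closed_Collect_le closed_Collect_eq continuous_on_sum
        continuous_on_product_coordinates continuous_on_const)
  finally show ?thesis .
qed

text \<open>Near a point with \<open>x v > 0\<close> only the finitely many simplices containing \<open>v\<close> matter, so
  local finiteness makes the weak topology coincide with that of pointwise convergence.\<close>

lemma realization_eq_top_of_set:
  assumes "locally_finite_complex \<K>"
  shows "realization \<K> = top_of_set (\<Union>s\<in>\<K>. closed_simplex s)"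
  unfolding topology_eq
proof (intro allI iffI)
  fix U :: "('a \<Rightarrow> real) set"
  let ?P = "\<Union>s\<in>\<K>. closed_simplex s"
  assume "openin (top_of_set ?P) U"
  then obtain V where V: "open V" "U = ?P \<inter> V"
    by (auto simp: openin_open)
  show "openin (realization \<K>) U"
    unfolding openin_realization
  proof (intro conjI ballI)
    show "U \<subseteq> ?P"
      using V by blast
    fix s assume "s \<in> \<K>"
    then have "U \<inter> closed_simplex s = closed_simplex s \<inter> V"
      using V by blast
    then show "openin (top_of_set (closed_simplex s)) (U \<inter> closed_simplex s)"
      using V(1) by (auto simp: openin_open)
  qed
next
  fix U :: "('a \<Rightarrow> real) set"
  let ?P = "\<Union>s\<in>\<K>. closed_simplex s"
  assume U: "openin (realization \<K>) U"
  then have "\<forall>s\<in>\<K>. \<exists>V. open V \<and> U \<inter> closed_simplex s = closed_simplex s \<inter> V"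
    by (simp add: openin_realization openin_open)
  then obtain V where V: "\<And>s. s \<in> \<K> \<Longrightarrow> open (V s)"
      "\<And>s. s \<in> \<K> \<Longrightarrow> U \<inter> closed_simplex s = closed_simplex s \<inter> V s"
    by metis
  show "openin (top_of_set ?P) U"
  proof (subst openin_subopen, intro ballI)
    fix x assume "x \<in> U"
    then obtain s where s: "s \<in> \<K>" "x \<in> closed_simplex s"
      using U by (auto simp: openin_realization)
    then obtain v where v: "v \<in> s" "0 < x v"
      by (rule_tac closed_simplex_positive_vertex)
    \<comment> \<open>Each \<open>V t \<union> - closed_simplex t\<close> is open and only asks
      points of \<open>closed_simplex t\<close> to lie in \<open>U\<close>. Local finiteness leaves
      finitely many such \<open>t\<close>, and \<open>0 < y v\<close> rules out every simplex
      without \<open>v\<close>.\<close>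
    define W where "W = {y. 0 < y v} \<inter> (\<Inter>t\<in>{t \<in> \<K>. v \<in> t}. V t \<union> - closed_simplex t)"
    have fin: "finite {t \<in> \<K>. v \<in> t}"
      using assms s v by (auto simp: locally_finite_complex_def)
    have "open W"
      unfolding W_def using V(1)
      by (intro open_Int open_coordinate_greater open_INT fin ballI open_Un open_Compl closed_closed_simplex) auto
    then have "openin (top_of_set ?P) (?P \<inter> W)"
      by (auto simp: openin_open)
    moreover have "x \<in> ?P \<inter> W"
    proof -
      have "x \<in> V t \<union> - closed_simplex t" if "t \<in> \<K>" for t
        using V(2)[OF that] \<open>x \<in> U\<close> by blast
      then show ?thesis
        using s v by (auto simp: W_def)
    qed
    moreover have "?P \<inter> W \<subseteq> U"
    proof
      fix y assume y: "y \<in> ?P \<inter> W"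
      then obtain t where t: "t \<in> \<K>" "y \<in> closed_simplex t"
        by auto
      then have "v \<in> t"
        using y closed_simplex_pos_imp_mem by (auto simp: W_def)
      then have "y \<in> closed_simplex t \<inter> V t"
        using y t by (auto simp: W_def)
      then show "y \<in> U"
        using V(2)[OF t(1)] by blast
    qed
    ultimately show "\<exists>T. openin (top_of_set ?P) T \<and> x \<in> T \<and> T \<subseteq> U"
      by blast
  qed
qed


text \<open>The realization is a subspace of a product of real lines, so continuity can be tested
  one coordinate at a time. Homotopies given by barycentric formulas are checked in this
  way.\<close>

lemma continuous_map_realization_iff:
  assumes "locally_finite_complex \<K>"
  shows "continuous_map Z (realization \<K>) f \<longleftrightarrow>
    (\<forall>v. continuous_map Z euclideanreal (\<lambda>z. f z v)) \<and>
    (\<forall>z\<in>topspace Z. \<exists>s\<in>\<K>. f z \<in> closed_simplex s)"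
  unfolding realization_eq_top_of_set[OF assms] continuous_map_in_subtopology
  by (auto simp: continuous_map_componentwise_UNIV simp flip: euclidean_product_topology)

text \<open>For \<open>c = 0\<close> this is the open star of \<open>v\<close>. Such stars serve as
  targets in compact-open neighbourhoods, and their preimages as pieces when continuous functions
  are glued.\<close>

lemma openin_realization_star:
  assumes "locally_finite_complex \<K>"
  shows "openin (realization \<K>) {y \<in> topspace (realization \<K>). c < y v}"
proof -
  have "{y \<in> topspace (realization \<K>). c < y v} = (\<Union>s\<in>\<K>. closed_simplex s) \<inter> {y. c < y v}"
    by (auto simp: topspace_realization)
  then show ?thesis
    by (simp add: realization_eq_top_of_set[OF assms] openin_open_Int open_coordinate_greater)
qed

section \<open>Homotopies of maps of pairs\<close>

lemma pair_homotopicI: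
  fixes X :: "'a topology" and P :: "'b topology"
  assumes "A \<subseteq> topspace X"
    and "continuous_map (prod_topology (top_of_set {0..1::real}) X) P h"
    and "\<And>x. x \<in> topspace X \<Longrightarrow> h (0, x) = f x"
    and "\<And>x. x \<in> topspace X \<Longrightarrow> h (1, x) = g x"
    and "\<And>t x. 0 \<le> t \<Longrightarrow> t \<le> 1 \<Longrightarrow> x \<in> A \<Longrightarrow> h (t, x) = p"
  shows "pair_homotopic X A P p f g"
proof -
  \<comment> \<open>Prescribing the ends of a homotopy on \<open>topspace X\<close> only is allowed
    by \<open>homotopic_with\<close> when the side condition ignores values elsewhere; it does,
    since \<open>A\<close> lies in the space.\<close>
  have "h ` A \<subseteq> {p} \<longleftrightarrow> k ` A \<subseteq> {p}" if "\<And>x. x \<in> topspace X \<Longrightarrow> h x = k x" for h k :: "'a \<Rightarrow> 'b"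
    using that assms(1) by (simp add: image_subset_iff subset_iff)
  note iff = homotopic_with[where P = "\<lambda>h. h ` A \<subseteq> {p}", OF this]
  show ?thesis
    unfolding pair_homotopic_def by (rule iffD2[OF iff], assumption) (use assms in \<open>auto intro!: exI[of _ h]\<close>)
qed

lemma pair_homotopicE:
  assumes "pair_homotopic X A P p f g"
  obtains h where "continuous_map (prod_topology (top_of_set {0..1::real}) X) P h"
    "\<And>x. h (0, x) = f x" "\<And>x. h (1, x) = g x"
    "\<And>t x. 0 \<le> t \<Longrightarrow> t \<le> 1 \<Longrightarrow> x \<in> A \<Longrightarrow> h (t, x) = p"
proof -
  obtain h where h: "continuous_map (prod_topology (top_of_set {0..1::real}) X) P h"
      "\<forall>x. h (0, x) = f x" "\<forall>x. h (1, x) = g x" "\<forall>t\<in>{0..1}. (\<lambda>x. h (t, x)) ` A \<subseteq> {p}"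
    using assms unfolding pair_homotopic_def homotopic_with_def by blast
  have "h (t, x) = p" if "0 \<le> t" "t \<le> 1" "x \<in> A" for t x
    using h(4)[rule_format, of t] that by auto
  with h(1-3) show thesis
    using that by blast
qed

lemma pair_homotopic_trans:
  "pair_homotopic X A P p f g \<Longrightarrow> pair_homotopic X A P p g k \<Longrightarrow> pair_homotopic X A P p f k"
  unfolding pair_homotopic_def by (rule homotopic_with_trans)

lemma pair_homotopic_restrict:
  assumes "pair_homotopic X A P p f g" "K \<subseteq> topspace X"
  shows "pair_homotopic (subtopology X K) (K \<inter> A) P p (restrict f K) (restrict g K)"
proof -
  obtain h where h: "continuous_map (prod_topology (top_of_set {0..1::real}) X) P h"
      "\<And>x. h (0, x) = f x" "\<And>x. h (1, x) = g x"
      "\<And>t x. 0 \<le> t \<Longrightarrow> t \<le> 1 \<Longrightarrow> x \<in> A \<Longrightarrow> h (t, x) = p"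
    by (fact pair_homotopicE[OF assms(1)])
  show ?thesis
  proof (rule pair_homotopicI[where h = h])
    show "continuous_map (prod_topology (top_of_set {0..1::real}) (subtopology X K)) P h"
      using h(1) by (simp add: prod_topology_subtopology(2) continuous_map_from_subtopology)
  qed (use h assms(2) in auto)
qed

section \<open>Homotopies in barycentric coordinates\<close>

text \<open>The segment from \<open>f z\<close> to \<open>g z\<close> stays in a common simplex by
  convexity, and it is stationary on \<open>A\<close>, where both ends equal
  \<open>p\<close>.\<close>

lemma pair_homotopic_linear:
  assumes fin: "locally_finite_complex \<K>" and A: "A \<subseteq> topspace Z"
    and f: "continuous_map Z (realization \<K>) f" "f ` A \<subseteq> {p}"
    and g: "continuous_map Z (realization \<K>) g" "g ` A \<subseteq> {p}"
    and common: "\<And>z. z \<in> topspace Z \<Longrightarrow> \<exists>s\<in>\<K>. f z \<in> closed_simplex s \<and> g z \<in> closed_simplex s"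
  shows "pair_homotopic Z A (realization \<K>) p f g"
proof (rule pair_homotopicI[OF A])
  let ?h = "\<lambda>(t, z) v. (1 - t) * f z v + t * g z v"
  let ?Z = "prod_topology (top_of_set {0..1::real}) Z"
  show "continuous_map ?Z (realization \<K>) ?h"
    unfolding continuous_map_realization_iff[OF fin]
  proof (intro conjI allI ballI)
    fix v
    have fst: "continuous_map ?Z euclideanreal fst"
      by (rule continuous_map_into_fulltopology[OF continuous_map_fst])
    have fg: "continuous_map ?Z euclideanreal (\<lambda>w. f (snd w) v)"
        "continuous_map ?Z euclideanreal (\<lambda>w. g (snd w) v)"
      using continuous_map_compose[OF continuous_map_snd, of Z euclideanreal "\<lambda>z. f z v"]
        continuous_map_compose[OF continuous_map_snd, of Z euclideanreal "\<lambda>z. g z v"] f(1) g(1)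
      by (simp_all add: continuous_map_realization_iff[OF fin] o_def)
    show "continuous_map ?Z euclideanreal (\<lambda>w. ?h w v)"
      unfolding case_prod_beta by (intro continuous_intros fst fg)
  next
    fix w assume "w \<in> topspace ?Z"
    then have w: "0 \<le> fst w" "fst w \<le> 1" "snd w \<in> topspace Z"
      by auto
    then obtain s where "s \<in> \<K>" "f (snd w) \<in> closed_simplex s" "g (snd w) \<in> closed_simplex s"
      using common by blast
    with w show "\<exists>s\<in>\<K>. ?h w \<in> closed_simplex s"
      unfolding case_prod_beta by (blast intro: convex_combination_closed_simplex)
  qed
  show "?h (t, x) = p" if "x \<in> A" for t x
  proof -
    have "f x = p" "g x = p"
      using that f(2) g(2) by auto
    then show ?thesis
      by (auto simp: algebra_simps)
  qed
qed auto

text \<open>The coordinatewise minimum, normalised, lies in every simplex containing \<open>f z\<close> and in every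
  simplex containing \<open>g z\<close>, so it connects the two maps by linear homotopies although \<open>f z\<close> and
  \<open>g z\<close> need not lie in a common simplex.\<close>

lemma pair_homotopic_common_vertex:
  assumes fin: "locally_finite_complex \<K>" "\<And>s. s \<in> \<K> \<Longrightarrow> finite s" and A: "A \<subseteq> topspace Z"
    and f: "continuous_map Z (realization \<K>) f" "f ` A \<subseteq> {p}"
    and g: "continuous_map Z (realization \<K>) g" "g ` A \<subseteq> {p}"
    and common: "\<And>z. z \<in> topspace Z \<Longrightarrow> \<exists>v. 0 < f z v \<and> 0 < g z v"
  shows "pair_homotopic Z A (realization \<K>) p f g"
proof -
  define m where "m z v = min (f z v) (g z v)" for z v
  define S where "S z = sum (m z) {v. m z v \<noteq> 0}" for z
  define c where "c z v = m z v / S z" for z v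
  have fs: "\<exists>s\<in>\<K>. f z \<in> closed_simplex s" and gs: "\<exists>s\<in>\<K>. g z \<in> closed_simplex s"
    if "z \<in> topspace Z" for z
    using f(1) g(1) that by (simp_all add: continuous_map_realization_iff[OF fin(1)])
  have nonneg: "0 \<le> f z v" "0 \<le> g z v" "0 \<le> m z v" if "z \<in> topspace Z" for z v
    using fs[OF that] gs[OF that] by (auto simp: closed_simplex_def m_def)
  \<comment> \<open>The support in the definition of \<open>S z\<close> moves with \<open>z\<close>;
    any finite set containing it may be summed over instead.\<close>
  have S_eq: "S z = sum (m z) F" if "finite F" "{v. m z v \<noteq> 0} \<subseteq> F" for z F
    unfolding S_def using that by (intro sum.mono_neutral_left) auto
  have supp: "{v. m z v \<noteq> 0} \<subseteq> s"
    if "z \<in> topspace Z" "f z \<in> closed_simplex s \<or> g z \<in> closed_simplex s" for z s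
  proof
    fix v assume "v \<in> {v. m z v \<noteq> 0}"
    then have "0 < m z v"
      using nonneg(3)[OF that(1), of v] by simp
    then have "0 < f z v" "0 < g z v"
      by (simp_all add: m_def)
    then show "v \<in> s"
      using that(2) closed_simplex_pos_imp_mem[of "f z" s v] closed_simplex_pos_imp_mem[of "g z" s v]
      by blast
  qed
  \<comment> \<open>A common vertex contributes a positive term, so the normalisation never divides
    by zero.\<close>
  have S_pos: "0 < S z" if z: "z \<in> topspace Z" for z
  proof -
    obtain s where s: "s \<in> \<K>" "f z \<in> closed_simplex s"
      using fs[OF z] by blast
    obtain v where v: "0 < m z v"
      using common[OF z] by (auto simp: m_def)
    have "finite {v. m z v \<noteq> 0}"
      using finite_subset[OF supp[OF z, of s] fin(2)[OF s(1)]] s(2) by simp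
    then have "m z v \<le> S z"
      unfolding S_def using v nonneg[OF z] by (intro member_le_sum) auto
    with v show ?thesis
      by simp
  qed
  have c_simplex: "c z \<in> closed_simplex s"
    if z: "z \<in> topspace Z" and s: "s \<in> \<K>" "f z \<in> closed_simplex s \<or> g z \<in> closed_simplex s" for z s
  proof -
    have "sum (m z) s = S z"
      using S_eq[OF fin(2)[OF s(1)] supp[OF z s(2)]] by simp
    moreover have "m z v = 0" if "v \<notin> s" for v
      using supp[OF z s(2)] that by auto
    ultimately show ?thesis
      using nonneg[OF z] S_pos[OF z] by (simp add: closed_simplex_def c_def flip: sum_divide_distrib)
  qed
  have cont_m: "continuous_map Z euclideanreal (\<lambda>z. m z v)" for v
    unfolding m_def using f(1) g(1)
    by (intro continuous_intros) (simp_all add: continuous_map_realization_iff[OF fin(1)])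
  \<comment> \<open>Where \<open>0 < f z v\<close>, every simplex containing \<open>f z\<close>
    contains \<open>v\<close>, so the support of \<open>m z\<close> lies in the union of the
    simplices around \<open>v\<close>, which is finite by local finiteness. Hence \<open>S\<close>
    is a fixed finite sum on each preimage of an open star, and these preimages cover
    \<open>Z\<close>.\<close>
  have cont_S: "continuous_map Z euclideanreal S"
  proof (rule pasting_lemma)
    let ?F = "\<lambda>v. \<Union>{s \<in> \<K>. v \<in> s}"
    let ?T = "\<lambda>v. {z \<in> topspace Z. f z \<in> {y \<in> topspace (realization \<K>). 0 < y v}}"
    have finF: "finite (?F v)" if "v \<in> \<Union>\<K>" for v
      using that fin by (auto simp: locally_finite_complex_def)
    show "openin Z (?T v)" for v
      using openin_continuous_map_preimage[OF f(1) openin_realization_star[OF fin(1)]] .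
    show "continuous_map (subtopology Z (?T v)) euclideanreal (\<lambda>z. sum (m z) (?F v))"
      if "v \<in> \<Union>\<K>" for v
      using that by (intro continuous_map_sum finF continuous_map_from_subtopology cont_m)
    have eq: "S z = sum (m z) (?F v)" if v: "v \<in> \<Union>\<K>" and z: "z \<in> topspace Z" "z \<in> ?T v" for z v
    proof -
      obtain s where s: "s \<in> \<K>" "f z \<in> closed_simplex s"
        using fs[OF z(1)] by blast
      then have "v \<in> s"
        using z closed_simplex_pos_imp_mem[of "f z" s v] by simp
      then show ?thesis
        using S_eq[OF finF[OF v]] supp[OF z(1), of s] s by blast
    qed
    show "sum (m z) (?F v) = sum (m z) (?F w)"
      if "v \<in> \<Union>\<K>" "w \<in> \<Union>\<K>" "z \<in> topspace Z \<inter> ?T v \<inter> ?T w" for v w z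
      using eq[of v z] eq[of w z] that by simp
    show "\<exists>v. v \<in> \<Union>\<K> \<and> z \<in> ?T v \<and> S z = sum (m z) (?F v)" if z: "z \<in> topspace Z" for z
    proof -
      obtain s where s: "s \<in> \<K>" "f z \<in> closed_simplex s"
        using fs[OF z] by blast
      then obtain v where "v \<in> s" "0 < f z v"
        by (rule_tac closed_simplex_positive_vertex)
      then have "v \<in> \<Union>\<K>" "z \<in> ?T v"
        using s z by (auto simp: topspace_realization)
      then show ?thesis
        using eq z by blast
    qed
  qed
  have cont_c: "continuous_map Z (realization \<K>) c"
    unfolding continuous_map_realization_iff[OF fin(1)]
  proof (intro conjI allI ballI)
    show "continuous_map Z euclideanreal (\<lambda>z. c z v)" for v
      unfolding c_def using S_pos by (intro continuous_intros cont_m cont_S) force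
    show "\<exists>s\<in>\<K>. c z \<in> closed_simplex s" if "z \<in> topspace Z" for z
      using fs[OF that] c_simplex[OF that] by blast
  qed
  \<comment> \<open>On \<open>A\<close> the minimum of \<open>p\<close> with itself is
    \<open>p\<close>, whose coordinates already sum to 1, so normalising changes nothing.\<close>
  have "c z = p" if z: "z \<in> A" for z
  proof -
    have Z: "z \<in> topspace Z" and fg: "f z = p" "g z = p"
      using A f(2) g(2) z by auto
    obtain s where s: "s \<in> \<K>" "f z \<in> closed_simplex s"
      using fs[OF Z] by blast
    have "m z = p"
      using fg by (auto simp: m_def)
    moreover have "S z = 1"
      using S_eq[OF fin(2) supp] s Z fg \<open>m z = p\<close> by (auto simp: closed_simplex_def)
    ultimately show ?thesis
      by (auto simp: c_def)
  qed
  then have c_A: "c ` A \<subseteq> {p}"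
    by auto
  \<comment> \<open>Any simplex containing \<open>f z\<close> also contains \<open>c z\<close>, so a
    linear homotopy applies; likewise for \<open>g z\<close>.\<close>
  have "pair_homotopic Z A (realization \<K>) p f c"
    using fs c_simplex by (intro pair_homotopic_linear fin A f cont_c c_A) blast
  moreover have "pair_homotopic Z A (realization \<K>) p c g"
    using gs c_simplex by (intro pair_homotopic_linear fin A g cont_c c_A) blast
  ultimately show ?thesis
    by (rule pair_homotopic_trans)
qed

section \<open>Approximation of phantom maps in the compact-open topology\<close>

lemma openin_compact_open_topology:
  assumes "compactin X K" "openin Y U"
  shows "openin (compact_open_topology X Y)
    {f \<in> extensional (topspace X). continuous_map X Y f \<and> f ` K \<subseteq> U}"
  unfolding compact_open_topology_def by (rule topology_generated_by_Basis) (use assms in blast)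

text \<open>A subbasic set constrains a map on one compact set only. Along the generation of the
  topology, intersections take the union of two compact sets and unions keep the compact set of a
  single member.\<close>

lemma compact_open_nbhd_agree_on_compact:
  assumes "openin (compact_open_topology X Y) T" "f \<in> T"
  obtains K where "compactin X K"
    "\<And>g. g \<in> topspace (compact_open_topology X Y) \<Longrightarrow> (\<And>x. x \<in> K \<Longrightarrow> g x = f x) \<Longrightarrow> g \<in> T"
proof -
  have "\<exists>K. compactin X K \<and>
      (\<forall>g \<in> topspace (compact_open_topology X Y). (\<forall>x\<in>K. g x = f x) \<longrightarrow> g \<in> T)"
    using openin_topology_generated_by[OF assms(1)[unfolded compact_open_topology_def]] assms(2)
  proof induction
    case (Int a b)
    then obtain K L where "compactin X K" "compactin X L"
      "\<forall>g \<in> topspace (compact_open_topology X Y). (\<forall>x\<in>K. g x = f x) \<longrightarrow> g \<in> a"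
      "\<forall>g \<in> topspace (compact_open_topology X Y). (\<forall>x\<in>L. g x = f x) \<longrightarrow> g \<in> b"
      by blast
    then show ?case
      by (intro exI[of _ "K \<union> L"]) (simp add: compactin_Un)
  next
    case (UN \<U>)
    then obtain W where "W \<in> \<U>" "f \<in> W"
      by blast
    with UN.IH show ?case
      by (meson UnionI)
  next
    case (Basis s)
    then obtain K U where "compactin X K" "f ` K \<subseteq> U"
        and s: "s = {f \<in> extensional (topspace X). continuous_map X Y f \<and> f ` K \<subseteq> U}"
      by blast
    then have "g \<in> s" if "g \<in> topspace (compact_open_topology X Y)" "\<forall>x\<in>K. g x = f x" for g
      using that by (simp add: topspace_compact_open_topology image_subset_iff)
    with \<open>compactin X K\<close> show ?case
      by blast
  qed simp
  then show thesis
    using that by blast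
qed

text \<open>The homotopy on a compact neighbourhood \<open>L\<close> of \<open>K\<close> is started at the time prescribed by a
  Urysohn function: time \<open>0\<close> on \<open>K\<close>, and time \<open>1\<close>, where it has reached \<open>p\<close>, outside the interior of \<open>L\<close>.\<close>

lemma phantom_agrees_with_null_homotopic_on_compact:
  assumes X: "normal_space X" "Hausdorff_space X" "locally_compact_space X"
    and A: "A \<subseteq> topspace X" and p: "p \<in> topspace P"
    and f: "f \<in> phantom_maps X A P p" and K: "compactin X K"
  obtains g where "g \<in> null_homotopic_maps X A P p" "\<And>x. x \<in> K \<Longrightarrow> g x = f x"
proof -
  obtain U L where L: "openin X U" "compactin X L" "closedin X L" "K \<subseteq> U" "U \<subseteq> L"
    using K X locally_compact_space_compact_closed_compact by metis
  have LX: "L \<subseteq> topspace X"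
    using L(3) closedin_subset by blast
  \<comment> \<open>The phantom property is applied on \<open>L\<close> rather than on
    \<open>K\<close>, to leave room for cutting the homotopy off.\<close>
  have hom: "pair_homotopic (subtopology X L) (L \<inter> A) P p (restrict f L) (restrict (const_map X p) L)"
    using f L(2) by (auto simp: phantom_maps_def weakly_homotopic_def)
  obtain h where h: "continuous_map (prod_topology (top_of_set {0..1::real}) (subtopology X L)) P h"
      "\<And>x. h (0, x) = restrict f L x" "\<And>x. h (1, x) = restrict (const_map X p) L x"
      "\<And>t x. 0 \<le> t \<Longrightarrow> t \<le> 1 \<Longrightarrow> x \<in> L \<inter> A \<Longrightarrow> h (t, x) = p"
    by (fact pair_homotopicE[OF hom])
  have h1: "h (1, x) = p" if "x \<in> L" for x
    using h(3) that LX by (auto simp: const_map_def)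
  have "closedin X K" "closedin X (topspace X - U)" "disjnt K (topspace X - U)"
    using K L X compactin_imp_closedin by (auto simp: disjnt_def)
  then obtain \<phi> where \<phi>: "continuous_map X (top_of_set {0..1::real}) \<phi>"
      "\<phi> ` K \<subseteq> {0}" "\<phi> ` (topspace X - U) \<subseteq> {1}"
    by (rule Urysohn_lemma[OF X(1) _ _ _ zero_le_one])
  have \<phi>01: "\<phi> x \<in> {0..1}" if "x \<in> topspace X" for x
    using \<phi>(1) that by (auto simp: continuous_map_in_subtopology)
  \<comment> \<open>The time \<open>max t (\<phi> x)\<close> stays in the unit interval and is never
    earlier than \<open>\<phi> x\<close>: \<open>t = 0\<close> gives the cut-off map and
    \<open>t = 1\<close> the constant \<open>p\<close>.\<close>
  define G where "G = (\<lambda>(t, x). if x \<in> L then h (max t (\<phi> x), x) else p)"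
  let ?Z = "prod_topology (top_of_set {0..1::real}) X"
  \<comment> \<open>The closed pieces over \<open>L\<close> and over the complement of
    \<open>U\<close> cover everything because \<open>U \<subseteq> L\<close>. On their overlap
    \<open>\<phi> = 1\<close>, which makes both formulas equal to \<open>p\<close>.\<close>
  let ?T = "\<lambda>b. {0..1::real} \<times> (if b then L else topspace X - U)"
  have contG: "continuous_map ?Z P G"
  proof (rule pasting_lemma_closed[where I = UNIV and T = ?T
        and f = "\<lambda>b w. if b then h (max (fst w) (\<phi> (snd w)), snd w) else p"])
    show "closedin ?Z (?T b)" for b
      using L by (auto simp: closedin_prod_Times_iff)
    show "continuous_map (subtopology ?Z (?T b)) P
        (\<lambda>w. if b then h (max (fst w) (\<phi> (snd w)), snd w) else p)" for b
    proof (cases b)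
      case True
      let ?Y = "prod_topology (top_of_set {0..1::real}) (subtopology X L)"
      have Y: "subtopology ?Z (?T b) = ?Y"
        using True by (simp add: prod_topology_subtopology(2))
      have s: "continuous_map ?Y (subtopology X L) snd" "continuous_map ?Y (top_of_set {0..1::real}) fst"
        by (rule continuous_map_snd continuous_map_fst)+
      have "continuous_map ?Y euclideanreal fst"
        by (rule continuous_map_into_fulltopology[OF s(2)])
      moreover have "continuous_map ?Y euclideanreal (\<lambda>w. \<phi> (snd w))"
        using continuous_map_compose[OF continuous_map_into_fulltopology[OF s(1)]
            continuous_map_into_fulltopology[OF \<phi>(1)]] by (simp add: o_def)
      ultimately have "continuous_map ?Y euclideanreal (\<lambda>w. max (fst w) (\<phi> (snd w)))"
        by (rule continuous_map_real_max)
      then have "continuous_map ?Y (top_of_set {0..1::real}) (\<lambda>w. max (fst w) (\<phi> (snd w)))"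
        using \<phi>01 by (fastforce simp: continuous_map_in_subtopology)
      then have "continuous_map ?Y ?Y (\<lambda>w. (max (fst w) (\<phi> (snd w)), snd w))"
        using s(1) by (simp add: continuous_map_paired)
      from continuous_map_compose[OF this h(1)] show ?thesis
        using True Y by (simp add: o_def)
    qed (use p in simp)
    have "h (max t (\<phi> x), x) = p" if "x \<in> L" "x \<in> topspace X - U" "t \<in> {0..1}" for t x
    proof -
      have "\<phi> x = 1"
        using \<phi>(3) that by auto
      then show ?thesis
        using that h1 by (simp add: max_def)
    qed
    then show "(if i then h (max (fst w) (\<phi> (snd w)), snd w) else p) =
        (if j then h (max (fst w) (\<phi> (snd w)), snd w) else p)"
      if "w \<in> topspace ?Z \<inter> ?T i \<inter> ?T j" for i j w
      using that by (auto split: if_splits)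
    show "\<exists>j. j \<in> UNIV \<and> w \<in> ?T j \<and> G w = (if j then h (max (fst w) (\<phi> (snd w)), snd w) else p)"
      if "w \<in> topspace ?Z" for w
      using that L(5) by (intro exI[of _ "snd w \<in> L"]) (auto simp: G_def)
  qed simp
  have G_A: "G (t, x) = p" if "x \<in> A" "0 \<le> t" "t \<le> 1" for t x
    using h(4)[of "max t (\<phi> x)" x] \<phi>01[of x] that A by (auto simp: G_def)
  have G1: "G (1, x) = p" if "x \<in> topspace X" for x
    using h1[of x] \<phi>01[OF that] by (auto simp: G_def max_def)
  define g where "g = (\<lambda>x\<in>topspace X. G (0, x))"
  have "continuous_map X P (\<lambda>x. G (0, x))"
    using continuous_map_compose[OF _ contG, of X "\<lambda>x. (0, x)"]
    by (simp add: continuous_map_paired o_def)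
  then have "continuous_map X P g"
    by (rule continuous_map_eq) (simp add: g_def)
  then have "g \<in> pair_maps X A P p"
    using A G_A by (auto simp: pair_maps_def g_def)
  moreover have "pair_homotopic X A P p g (const_map X p)"
    by (rule pair_homotopicI[OF A contG]) (use G_A G1 in \<open>auto simp: g_def const_map_def\<close>)
  moreover have "g x = f x" if "x \<in> K" for x
  proof -
    have "x \<in> L" "x \<in> topspace X" "\<phi> x = 0"
      using that L LX \<phi>(2) by auto
    then show ?thesis
      by (simp add: g_def G_def h(2))
  qed
  ultimately show thesis
    using that by (auto simp: null_homotopic_maps_def)
qed

section \<open>Vertex stars and compact-open neighbourhoods\<close>

text \<open>Compactness reduces the positive coordinates of \<open>f\<close> on \<open>K\<close> to
  finitely many. The pieces are made compact because subbasic compact-open sets constrain maps on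
  compact sets.\<close>

lemma compact_cover_by_stars:
  fixes X :: "'a topology"
  assumes fin: "locally_finite_complex \<K>"
    and f: "continuous_map X (realization \<K>) f" and K: "compactin X K"
  obtains F :: "'a set" and C v where "finite F" "K \<subseteq> (\<Union>i\<in>F. C i)" "\<And>i. i \<in> F \<Longrightarrow> compactin X (C i)"
    "\<And>i x. i \<in> F \<Longrightarrow> x \<in> C i \<Longrightarrow> 0 < f x (v i)"
proof -
  have KX: "K \<subseteq> topspace X"
    using K by (rule compactin_subset_topspace)
  have cont: "continuous_map X euclideanreal (\<lambda>x. f x v)"
    and fs: "x \<in> topspace X \<Longrightarrow> \<exists>s\<in>\<K>. f x \<in> closed_simplex s" for v x
    using f by (simp_all add: continuous_map_realization_iff[OF fin])
  have "\<exists>v. 0 < f x v" if "x \<in> K" for x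
    using fs[of x] that KX closed_simplex_positive_vertex by (metis subsetD)
  then obtain v where v: "\<And>x. x \<in> K \<Longrightarrow> 0 < f x (v x)"
    by metis
  \<comment> \<open>Half the value at \<open>x\<close> separates two needs: the strict bound gives
    open sets for extracting a finite subcover, the weak bound gives larger closed sets on which the
    coordinate is still positive.\<close>
  define U where "U x = {z \<in> topspace X. f z (v x) \<in> {f x (v x) / 2<..}}" for x
  define D where "D x = {z \<in> topspace X. f z (v x) \<in> {f x (v x) / 2..}}" for x
  have "openin X (U x)" for x
    unfolding U_def by (rule openin_continuous_map_preimage[OF cont]) simp
  moreover have "K \<subseteq> \<Union>(U ` K)"
    using v KX by (force simp: U_def)
  ultimately obtain \<F> where \<F>: "finite \<F>" "\<F> \<subseteq> U ` K" "K \<subseteq> \<Union>\<F>"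
    using compactinD[OF K, of "U ` K"] by blast
  then obtain F where F: "F \<subseteq> K" "finite F" "\<F> = U ` F"
    by (meson finite_subset_image)
  show thesis
  proof (rule that[of F "\<lambda>x. D x \<inter> K" v])
    show "K \<subseteq> (\<Union>x\<in>F. D x \<inter> K)"
      using \<F>(3) F(3) by (fastforce simp: U_def D_def)
    show "compactin X (D x \<inter> K)" for x
      unfolding D_def
      by (intro closed_Int_compactin closedin_continuous_map_preimage[OF cont] K) simp
    show "0 < f z (v x)" if "x \<in> F" "z \<in> D x \<inter> K" for x z
      using v[of x] that F(1) by (auto simp: D_def)
  qed (fact F)
qed

text \<open>Sending each compact piece \<open>C i\<close> into the open star of \<open>v i\<close>
  is a finite list of subbasic conditions met by \<open>f\<close>; any other map meeting them shares
  the vertex \<open>v i\<close> with \<open>f\<close> on \<open>C i\<close>.\<close>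

lemma compact_open_nbhd_common_vertex:
  fixes X :: "'a topology"
  assumes fin: "locally_finite_complex \<K>"
    and f: "f \<in> topspace (compact_open_topology X (realization \<K>))" and K: "compactin X K"
  obtains T where "openin (compact_open_topology X (realization \<K>)) T" "f \<in> T"
    "\<And>g x. g \<in> T \<Longrightarrow> x \<in> K \<Longrightarrow> \<exists>v. 0 < f x v \<and> 0 < g x v"
proof -
  let ?P = "realization \<K>"
  have f': "f \<in> extensional (topspace X)" "continuous_map X ?P f"
    using f by (simp_all add: topspace_compact_open_topology)
  obtain F :: "'a set" and C v where C: "finite F" "K \<subseteq> (\<Union>i\<in>F. C i)" "\<And>i. i \<in> F \<Longrightarrow> compactin X (C i)"
      "\<And>i x. i \<in> F \<Longrightarrow> x \<in> C i \<Longrightarrow> 0 < f x (v i)"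
    by (fact compact_cover_by_stars[OF fin f'(2) K])
  define N where "N i = {g \<in> extensional (topspace X). continuous_map X ?P g \<and>
      g ` C i \<subseteq> {y \<in> topspace ?P. 0 < y (v i)}}" for i
  \<comment> \<open>Inserting the whole space keeps \<open>T\<close> inside the topology when
    \<open>F\<close> is empty.\<close>
  define T where "T = \<Inter>(insert (topspace (compact_open_topology X ?P)) (N ` F))"
  have "openin (compact_open_topology X ?P) (N i)" if "i \<in> F" for i
    unfolding N_def
    using that by (intro openin_compact_open_topology C openin_realization_star fin)
  then have "openin (compact_open_topology X ?P) T"
    unfolding T_def by (intro openin_Inter) (use C(1) in auto)
  moreover have "f \<in> N i" if "i \<in> F" for i
  proof -
    have "f x \<in> topspace ?P" if "x \<in> C i" for x
      using that compactin_subset_topspace[OF C(3)[OF \<open>i \<in> F\<close>]] f'(2)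
      by (auto simp: continuous_map_def Pi_iff)
    then show ?thesis
      using f' C(4) that by (auto simp: N_def)
  qed
  then have "f \<in> T"
    using f by (simp add: T_def)
  moreover have "\<exists>v. 0 < f x v \<and> 0 < g x v" if g: "g \<in> T" and x: "x \<in> K" for g x
  proof -
    obtain i where i: "i \<in> F" "x \<in> C i"
      using x C(2) by blast
    then have "g \<in> N i"
      using g by (auto simp: T_def)
    then have "0 < g x (v i)"
      using i by (auto simp: N_def)
    with C(4)[OF i] show ?thesis
      by blast
  qed
  ultimately show thesis
    using that by blast
qed

section \<open>Phantom maps as a closure\<close>

theorem proposition7p9:
  fixes X :: "'a topology" and A :: "'a set"
    and \<K> :: "'v set set" and p :: "'v \<Rightarrow> real"
  assumes "locally_compact_pair X A"
    and "abstract_simplicial_complex \<K>" and "countable \<K>" and "locally_finite_complex \<K>"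
    and "p \<in> topspace (realization \<K>)"
  shows "phantom_maps X A (realization \<K>) p =
    pair_maps_topology X A (realization \<K>) p closure_of null_homotopic_maps X A (realization \<K>) p"
proof (intro subset_antisym subsetI)
  let ?P = "realization \<K>"
  have X: "normal_space X" "Hausdorff_space X" "locally_compact_space X" and AX: "A \<subseteq> topspace X"
    using assms(1) by (simp_all add: locally_compact_pair_def completely_metrizable_imp_metrizable_space
        metrizable_imp_normal_space metrizable_imp_Hausdorff_space closedin_subset)
  have finite_simplex: "finite s" if "s \<in> \<K>" for s
    using assms(2) that by (simp add: abstract_simplicial_complex_def)
  {
    fix f assume f: "f \<in> phantom_maps X A ?P p"
    show "f \<in> pair_maps_topology X A ?P p closure_of null_homotopic_maps X A ?P p"
      unfolding in_closure_of
    proof (intro conjI allI impI)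
      show "f \<in> topspace (pair_maps_topology X A ?P p)"
        using f by (simp add: topspace_pair_maps_topology phantom_maps_def)
      fix T assume T: "f \<in> T \<and> openin (pair_maps_topology X A ?P p) T"
      then obtain W where W: "openin (compact_open_topology X ?P) W" "T = W \<inter> pair_maps X A ?P p"
        by (auto simp: pair_maps_topology_def openin_subtopology)
      \<comment> \<open>It suffices to match \<open>f\<close> on this one compact set, and a
        null-homotopic map can do so.\<close>
      then obtain K where K: "compactin X K" "\<And>g. g \<in> topspace (compact_open_topology X ?P) \<Longrightarrow>
          (\<And>x. x \<in> K \<Longrightarrow> g x = f x) \<Longrightarrow> g \<in> W"
        using compact_open_nbhd_agree_on_compact T by (metis IntD1)
      obtain g where g: "g \<in> null_homotopic_maps X A ?P p" "\<And>x. x \<in> K \<Longrightarrow> g x = f x"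
        by (fact phantom_agrees_with_null_homotopic_on_compact[OF X AX assms(5) f K(1)])
      then have "g \<in> pair_maps X A ?P p"
        by (simp add: null_homotopic_maps_def)
      moreover from this have "g \<in> W"
        by (intro K(2) g(2)) (simp_all add: pair_maps_def topspace_compact_open_topology)
      ultimately show "\<exists>y. y \<in> null_homotopic_maps X A ?P p \<and> y \<in> T"
        using g(1) W(2) by blast
    qed
  next
    fix f assume f: "f \<in> pair_maps_topology X A ?P p closure_of null_homotopic_maps X A ?P p"
    then have fm: "f \<in> pair_maps X A ?P p"
      by (simp add: in_closure_of topspace_pair_maps_topology)
    \<comment> \<open>The homotopy on \<open>K\<close> has two stages: from \<open>f\<close> to a
      nearby null-homotopic \<open>g\<close> through common vertices, then from \<open>g\<close> to
      the constant map by restricting its null-homotopy.\<close>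
    have "pair_homotopic (subtopology X K) (K \<inter> A) ?P p (restrict f K) (restrict (const_map X p) K)"
      if K: "compactin X K" for K
    proof -
      have KX: "K \<subseteq> topspace X"
        using K by (rule compactin_subset_topspace)
      have f_top: "f \<in> topspace (compact_open_topology X ?P)"
        using fm by (simp add: pair_maps_def topspace_compact_open_topology)
      obtain T where T: "openin (compact_open_topology X ?P) T" "f \<in> T"
          "\<And>g x. g \<in> T \<Longrightarrow> x \<in> K \<Longrightarrow> \<exists>v. 0 < f x v \<and> 0 < g x v"
        by (fact compact_open_nbhd_common_vertex[OF assms(4) f_top K])
      have "openin (pair_maps_topology X A ?P p) (T \<inter> pair_maps X A ?P p)"
        using T(1) by (auto simp: pair_maps_topology_def openin_subtopology)
      then obtain g where g: "g \<in> null_homotopic_maps X A ?P p" "g \<in> T"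
        using f fm T(2) unfolding in_closure_of by (metis IntD1 IntI)
      have restrict: "continuous_map (subtopology X K) ?P (restrict k K)"
          "restrict k K ` (K \<inter> A) \<subseteq> {p}" if "k \<in> pair_maps X A ?P p" for k
        using that by (auto simp: pair_maps_def
            intro: continuous_map_eq[OF continuous_map_from_subtopology])
      have gm: "g \<in> pair_maps X A ?P p" "pair_homotopic X A ?P p g (const_map X p)"
        using g(1) by (simp_all add: null_homotopic_maps_def)
      have "pair_homotopic (subtopology X K) (K \<inter> A) ?P p (restrict f K) (restrict g K)"
        by (rule pair_homotopic_common_vertex)
          (use assms(4) finite_simplex KX AX restrict[OF fm] restrict[OF gm(1)] T(3)[OF g(2)] in auto)
      then show ?thesis
        using pair_homotopic_restrict[OF gm(2) KX] by (rule pair_homotopic_trans)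
    qed
    with fm show "f \<in> phantom_maps X A ?P p"
      by (auto simp: phantom_maps_def weakly_homotopic_def)
  }
qed

end
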